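(* Fix $t>0$. Let $P$ be a $t$-convex polygon in the Lorentz plane. Then $P$ is a proper convex subset of $\mathbb{R}^2$ contained in $\mathcal{F}$, bounded by a polygonal line with a countable number of sides, and globally invariant under the action of the group $\langle H_t\rangle$.
   Context: The Lorentz plane is $\mathbb{R}^2$ with the bilinear form $\langle x,y\rangle_1=x_1y_1-x_2y_2$. Let $\mathcal{F}=\{x\in\mathbb{R}^2 : \langle x,x\rangle_1<0,\ x_2>0\}$ (future time-like vectors) and $\mathbb{H}=\{x\in\mathbb{R}^2:\langle x,x\rangle_1=-1,\ x_2>0\}$. For $s\in\mathbb{R}$ let $H_s=\begin{pmatrix}\cosh s&\sinh s\\ \sinh s&\cosh s\end{pmatrix}$ (hyperbolic translation), and $\langle H_t\rangle$ the group generated by $H_t$. For $a\in\mathcal{F}$, $a^{\bot}=\{x\in\mathbb{R}^2:\langle x,a\rangle_1=\langle a,a\rangle_1\}$. A $t$-convex polygon is defined as follows: given $n\geq1$ pairwise distinct vectors $\eta_1,\dots,\eta_n\in\mathbb{H}$ and positive numbers $h_1,\dots,h_n$, it is the intersection, over all $k\in\mathbb{Z}$ and $i=1,\dots,n$, of the closed half-planes bounded by the lines $(H_t^k(h_i\eta_i))^{\bot}$, each half-plane chosen so that the vector $H_t^k\eta_i$ points into it (i.e. the half-plane $\{x:\langle x,H_t^k\eta_i\rangle_1\le -h_i\}$). *)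

theory Defs
  imports "HOL-Analysis.Analysis"
begin

text \<open>The Lorentz plane: vectors of real^2, with components x$1, x$2.\<close>

definition lor :: "real^2 \<Rightarrow> real^2 \<Rightarrow> real" where
  "lor x y = x$1 * y$1 - x$2 * y$2"

definition future_cone :: "(real^2) set" where
  "future_cone = {x. lor x x < 0 \<and> x$2 > 0}"

definition hyperbola :: "(real^2) set" where
  "hyperbola = {x. lor x x = -1 \<and> x$2 > 0}"

text \<open>Hyperbolic translation H_s.\<close>
definition Hmat :: "real \<Rightarrow> real^2^2" where
  "Hmat s = (\<chi> i j. if i = j then cosh s else sinh s)"

text \<open>Action of H_t^k (k an integer) on the plane.\<close>
definition Hpow :: "real \<Rightarrow> int \<Rightarrow> real^2 \<Rightarrow> real^2" where
  "Hpow t k = (if k \<ge> 0 then ((*v) (Hmat t)) ^^ nat k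
               else ((*v) (matrix_inv (Hmat t))) ^^ nat (- k))"

text \<open>Closed half-plane bounded by (H_t^k(h eta))^perp into which H_t^k eta points.\<close>
definition halfplane :: "real \<Rightarrow> int \<Rightarrow> real \<Rightarrow> real^2 \<Rightarrow> (real^2) set" where
  "halfplane t k h \<eta> = {x. lor x (Hpow t k \<eta>) \<le> - h}"

definition t_convex_polygon :: "real \<Rightarrow> (real^2) set \<Rightarrow> bool" where
  "t_convex_polygon t P \<longleftrightarrow>
     (\<exists>n::nat. \<exists>\<eta>::nat \<Rightarrow> real^2. \<exists>h::nat \<Rightarrow> real.
        n \<ge> 1 \<and> (\<forall>i<n. \<eta> i \<in> hyperbola) \<and> inj_on \<eta> {..<n} \<and> (\<forall>i<n. h i > 0) \<and>
        P = (\<Inter>k::int. \<Inter>i\<in>{..<n}. halfplane t k (h i) (\<eta> i)))"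

end

theory Submission
  imports Defs "HOL-Real_Asymp.Real_Asymp"
begin

text \<open>
  Write points of the future cone as \<open>r (sinh \<theta>, cosh \<theta>)\<close> with \<open>r > 0\<close>. If \<open>\<eta>\<^sub>i\<close> has rapidity
  \<open>\<phi>\<^sub>i\<close>, the half-plane of \<open>H\<^sub>t\<^sup>k (h\<^sub>i \<eta>\<^sub>i)\<close> reads \<open>r \<ge> h\<^sub>i / cosh (\<theta> - \<phi>\<^sub>i - k t)\<close>, so the polygon is the
  region above the supremum of countably many radius functions. As \<open>k\<close> runs through \<open>\<int>\<close> the
  normals sweep out the whole hyperbola, which forces the polygon into the future cone.

  Only finitely many faces can be maximal for \<open>\<theta> \<in> [0, t]\<close>, and two distinct radius functions
  agree at most once; between consecutive crossings a single face is maximal, and \<open>H\<^sub>t\<close> repeats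
  this picture with period \<open>t\<close>. While one face is maximal, the boundary point of rapidity \<open>\<theta>\<close>
  runs along a segment of that face's line, and these segments form the polygonal boundary.
  Since \<open>H\<^sub>t\<close> preserves the Lorentz form and permutes the faces, it preserves the polygon.
\<close>

section \<open>Elementary real analysis\<close>

lemma exp_combination_eq_0_twice:
  fixes A B :: real
  assumes "A * exp x + B * exp (- x) = 0" "A * exp y + B * exp (- y) = 0" "x \<noteq> y"
  shows "A = 0 \<and> B = 0"
proof -
  have quad: "A * exp (2 * z) + B = 0" if "A * exp z + B * exp (- z) = 0" for z
  proof -
    have "(A * exp z + B * exp (- z)) * exp z = 0" using that by simp
    then show ?thesis by (simp add: algebra_simps exp_minus mult_exp_exp)
  qed
  have "exp (2 * x) \<noteq> exp (2 * y)" using assms(3) by simp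
  then have "A = 0" using quad[OF assms(1)] quad[OF assms(2)] by (metis add_right_cancel mult_cancel_left)
  with quad[OF assms(1)] show ?thesis by simp
qed

lemma cosh_gt_abs_half: "cosh (x::real) > \<bar>x\<bar> / 2"
proof -
  have "exp \<bar>x\<bar> \<ge> 1 + \<bar>x\<bar>" by (rule exp_ge_add_one_self)
  moreover have "cosh x \<ge> exp \<bar>x\<bar> / 2"
    by (cases "x \<ge> 0") (simp_all add: cosh_def)
  ultimately show ?thesis by linarith
qed

lemma exp_decay_not_bounded_below:
  fixes b c p t :: real
  assumes "c > 0" "t > 0"
  shows "\<not> (\<forall>k::nat. c \<le> b * exp (- (p + real k * t)))"
proof
  assume bound: "\<forall>k::nat. c \<le> b * exp (- (p + real k * t))"
  have "(\<lambda>k::nat. b * exp (- (p + real k * t))) \<longlonglongrightarrow> 0"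
    using assms(2) by real_asymp
  then have "c \<le> 0" using bound by (intro LIMSEQ_le_const) auto
  with assms(1) show False by simp
qed

lemma continuous_nonneg_on_interval:
  fixes g :: "real \<Rightarrow> real"
  assumes cont: "continuous_on {p..q} g" and m: "m \<in> {p<..<q}" "g m \<ge> 0"
    and nonzero: "\<And>z. z \<in> {p<..<q} \<Longrightarrow> g z \<noteq> 0" and x: "x \<in> {p..q}"
  shows "g x \<ge> 0"
proof -
  have inner: "g z \<ge> 0" if z: "z \<in> {p<..<q}" for z
  proof (rule ccontr)
    assume "\<not> g z \<ge> 0"
    then have "0 \<in> closed_segment (g z) (g m)"
      using m(2) by (simp add: closed_segment_eq_real_ivl)
    moreover have seg: "closed_segment z m \<subseteq> {p<..<q}"
      using z m(1) by (simp add: closed_segment_subset)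
    moreover have "continuous_on (closed_segment z m) g"
      by (rule continuous_on_subset[OF cont]) (use seg in auto)
    ultimately obtain w where "w \<in> {p<..<q}" "g w = 0"
      using IVT'_closed_segment_real by blast
    with nonzero show False by blast
  qed
  have "p < q" using m(1) by simp
  then show ?thesis
    using continuous_ge_on_closure[of "{p<..<q}" g x 0] cont x inner by simp
qed

text \<open>Differences of members cannot change sign inside \<open>[p, q]\<close>, so the member that is
  maximal at the midpoint stays maximal on \<open>[p, q]\<close>.\<close>
lemma finite_family_dominant:
  fixes f :: "'j \<Rightarrow> real \<Rightarrow> real"
  assumes "finite J" "J \<noteq> {}" "p < q"
    and cont: "\<And>j. j \<in> J \<Longrightarrow> continuous_on {p..q} (f j)"
    and cross: "\<And>a b z. a \<in> J \<Longrightarrow> b \<in> J \<Longrightarrow> z \<in> {p<..<q} \<Longrightarrow> f a z = f b z \<Longrightarrow>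
                  \<forall>x\<in>{p..q}. f a x = f b x"
  shows "\<exists>d\<in>J. \<forall>j\<in>J. \<forall>x\<in>{p..q}. f j x \<le> f d x"
proof -
  define m where "m = (p + q) / 2"
  have m: "m \<in> {p<..<q}" using \<open>p < q\<close> by (simp add: m_def)
  have "Max ((\<lambda>j. f j m) ` J) \<in> (\<lambda>j. f j m) ` J"
    using assms(1,2) by (intro Max_in) auto
  then obtain d where d: "d \<in> J" "f d m = Max ((\<lambda>j. f j m) ` J)" by auto
  have "f d x - f j x \<ge> 0" if j: "j \<in> J" and x: "x \<in> {p..q}" for j x
  proof (cases "\<forall>y\<in>{p..q}. f d y = f j y")
    case False
    show ?thesis
    proof (rule continuous_nonneg_on_interval[OF _ m _ _ x])
      show "continuous_on {p..q} (\<lambda>y. f d y - f j y)"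
        using cont d(1) j by (intro continuous_intros)
      show "f d m - f j m \<ge> 0" using d assms(1) j by simp
      show "f d z - f j z \<noteq> 0" if "z \<in> {p<..<q}" for z
        using cross[OF d(1) j that] False by auto
    qed
  qed (use x in simp)
  with d(1) show ?thesis by (intro bexI[of _ d] ballI) auto
qed

lemma finite_int_affine_bounded:
  fixes a t M :: real
  assumes "t > 0" shows "finite {k::int. \<bar>a + of_int k * t\<bar> < M}"
proof -
  define K where "K = \<lceil>(\<bar>M\<bar> + \<bar>a\<bar>) / t\<rceil>"
  have "\<bar>k\<bar> \<le> K" if "\<bar>a + of_int k * t\<bar> < M" for k
  proof -
    have "\<bar>of_int k\<bar> * t < \<bar>M\<bar> + \<bar>a\<bar>"
      using that assms by (simp add: abs_mult)
    then have "of_int \<bar>k\<bar> \<le> (\<bar>M\<bar> + \<bar>a\<bar>) / t"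
      using assms by (simp add: pos_le_divide_eq)
    then show ?thesis unfolding K_def by linarith
  qed
  then have "{k::int. \<bar>a + of_int k * t\<bar> < M} \<subseteq> {-K..K}"
    by (auto simp: abs_le_iff) (smt (verit))
  then show ?thesis by (rule finite_subset) simp
qed

section \<open>Periodic enumeration of a finite set\<close>

lemma nth_interval_cover:
  fixes ys :: "'a::linorder list"
  assumes "ys ! 0 \<le> x" "x < ys ! N"
  shows "\<exists>l<N. ys ! l \<le> x \<and> x < ys ! Suc l"
  using assms(2)
proof (induction N)
  case 0 with assms(1) show ?case by simp
next
  case (Suc N)
  then show ?case
    by (cases "x < ys ! N") (auto intro: less_SucI)
qed

lemma sorted_wrt_less_nth_gap:
  fixes ys :: "'a::linorder list"
  assumes "sorted_wrt (<) ys" "Suc l < length ys" "z \<in> set ys"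
  shows "z \<notin> {ys ! l <..< ys ! Suc l}"
proof -
  obtain j where j: "j < length ys" "z = ys ! j" using assms(3) by (auto simp: in_set_conv_nth)
  have "ys ! j \<le> ys ! l \<or> ys ! Suc l \<le> ys ! j"
    using sorted_nth_mono[OF strict_sorted_imp_sorted[OF assms(1)]] j(1) assms(2)
    by (cases "j \<le> l") auto
  with j(2) show ?thesis by auto
qed

lemma periodic_enumeration:
  fixes B :: "real set" and t :: real
  assumes B: "finite B" "0 \<in> B" "B \<subseteq> {0..<t}"
  shows "\<exists>s :: int \<Rightarrow> real. (\<forall>k. s k < s (k + 1)) \<and> (\<forall>x. \<exists>k. s k \<le> x \<and> x \<le> s (k + 1)) \<and>
    (\<forall>k. \<exists>q::int. 0 \<le> s k - q * t \<and> s (k + 1) - q * t \<le> t \<and>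
                  {s k - q * t <..< s (k + 1) - q * t} \<inter> B = {})"
proof -
  define xs where "xs = sorted_list_of_set B"
  define N where "N = length xs"
  define ys where "ys = xs @ [t]"
  have set_xs: "set xs = B" using B(1) by (simp add: xs_def)
  have t: "t > 0" using B(2,3) by auto
  have sorted_ys: "sorted_wrt (<) ys"
    using B(3) set_xs by (auto simp: ys_def sorted_wrt_append xs_def)
  have N: "N > 0" using B(2) set_xs by (auto simp: N_def)
  have len_ys: "length ys = Suc N" by (simp add: ys_def N_def)
  have ys_last: "ys ! N = t" by (simp add: ys_def N_def)
  have sorted: "\<And>i j. i \<le> j \<Longrightarrow> j < length ys \<Longrightarrow> ys ! i \<le> ys ! j"
    by (rule sorted_nth_mono[OF strict_sorted_imp_sorted[OF sorted_ys]])
  have ys_0: "ys ! 0 = 0"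
  proof -
    obtain j where "j < N" "xs ! j = 0" using B(2) set_xs by (auto simp: N_def in_set_conv_nth)
    then have "ys ! 0 \<le> 0" using sorted[of 0 j] len_ys by (simp add: ys_def nth_append N_def)
    moreover have "ys ! 0 \<in> B" using N set_xs nth_mem[of 0 xs] by (simp add: ys_def N_def nth_append)
    ultimately show ?thesis using B(3) by force
  qed
  define s where "s k = ys ! nat (k mod int N) + of_int (k div int N) * t" for k
  have s_decomp: "s (q * int N + int l) = ys ! l + of_int q * t" if "l \<le> N" for q l
  proof (cases "l < N")
    case True then show ?thesis by (simp add: s_def)
  next
    case False
    with that have "q * int N + int l = (q + 1) * int N + 0" by (simp add: algebra_simps)
    then show ?thesis using False that ys_0 ys_last N by (simp add: s_def algebra_simps)
  qed
  have s_step: "\<exists>q. \<exists>l<N. s k = ys ! l + of_int q * t \<and> s (k + 1) = ys ! Suc l + of_int q * t" for k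
  proof (intro exI conjI)
    define q l where "q = k div int N" and "l = nat (k mod int N)"
    have k: "k = q * int N + int l" using N by (simp add: q_def l_def)
    show "l < N" using N by (simp add: l_def nat_less_iff)
    show "s k = ys ! l + of_int q * t" "s (k + 1) = ys ! Suc l + of_int q * t"
      using s_decomp[of l q] s_decomp[of "Suc l" q] \<open>l < N\<close> by (simp_all add: k add.assoc add.commute)
  qed
  show ?thesis
  proof (intro exI[of _ s] conjI allI)
    fix k
    from s_step obtain q l where l: "l < N" "s k = ys ! l + of_int q * t"
      "s (k + 1) = ys ! Suc l + of_int q * t" by blast
    show "s k < s (k + 1)"
      using sorted_wrt_nth_less[OF sorted_ys, of l "Suc l"] l len_ys by simp
    have "0 \<le> ys ! l" "ys ! Suc l \<le> t"
      using sorted[of 0 l] sorted[of "Suc l" N] l(1) len_ys ys_0 ys_last by auto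
    moreover have "{ys ! l <..< ys ! Suc l} \<inter> B = {}"
      using sorted_wrt_less_nth_gap[OF sorted_ys] l(1) len_ys set_xs by (auto simp: ys_def)
    ultimately show "\<exists>q::int. 0 \<le> s k - q * t \<and> s (k + 1) - q * t \<le> t \<and>
                  {s k - q * t <..< s (k + 1) - q * t} \<inter> B = {}"
      using l by (intro exI[of _ q]) simp
  next
    fix x
    define q where "q = \<lfloor>x / t\<rfloor>"
    have "of_int q \<le> x / t" "x / t < of_int q + 1" unfolding q_def by linarith+
    then have "0 \<le> x - of_int q * t" "x - of_int q * t < t"
      using t by (simp_all add: field_simps)
    then obtain l where l: "l < N" "ys ! l \<le> x - of_int q * t" "x - of_int q * t < ys ! Suc l"
      using nth_interval_cover[of ys "x - of_int q * t" N] ys_0 ys_last by auto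
    show "\<exists>k. s k \<le> x \<and> x \<le> s (k + 1)"
      using l s_decomp[of l q] s_decomp[of "Suc l" q]
      by (intro exI[of _ "q * int N + int l"]) (simp add: add.assoc add.commute)
  qed
qed

section \<open>Hyperbolic coordinates on the Lorentz plane\<close>

definition hyperbola_point :: "real \<Rightarrow> real^2" where
  "hyperbola_point a = (\<chi> i. if i = 1 then sinh a else cosh a)"

lemma hyperbola_point_nth [simp]:
  "hyperbola_point a $ 1 = sinh a" "hyperbola_point a $ 2 = cosh a"
  by (simp_all add: hyperbola_point_def)

lemma vec2_eq_iff: "(x::real^2) = y \<longleftrightarrow> x$1 = y$1 \<and> x$2 = y$2"
  by (simp add: vec_eq_iff forall_2)

lemma Hmat_mult_nth [simp]:
  "(Hmat s *v x) $ 1 = cosh s * x$1 + sinh s * x$2"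
  "(Hmat s *v x) $ 2 = sinh s * x$1 + cosh s * x$2"
  by (simp_all add: Hmat_def matrix_vector_mult_def sum_2)

lemma Hmat_hyperbola_point: "Hmat s *v hyperbola_point a = hyperbola_point (a + s)"
  by (simp add: vec2_eq_iff sinh_add cosh_add algebra_simps)

lemma Hmat_mult_Hmat: "Hmat s *v (Hmat r *v x) = Hmat (s + r) *v x"
  by (simp add: vec2_eq_iff sinh_add cosh_add algebra_simps)

lemma Hmat_zero: "Hmat 0 = mat 1"
  by (simp add: Hmat_def mat_def vec_eq_iff)

lemma Hmat_matrix_mult: "Hmat s ** Hmat r = Hmat (s + r)"
  by (rule matrix_eq[THEN iffD2]) (simp add: matrix_vector_mul_assoc[symmetric] Hmat_mult_Hmat)

lemma matrix_inv_Hmat: "matrix_inv (Hmat t) = Hmat (- t)"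
proof -
  have "\<exists>A'. Hmat t ** A' = mat 1 \<and> A' ** Hmat t = mat 1"
    by (rule exI[of _ "Hmat (- t)"]) (simp add: Hmat_matrix_mult Hmat_zero)
  then have "Hmat t ** matrix_inv (Hmat t) = mat 1"
    unfolding matrix_inv_def by (rule someI_ex[THEN conjunct1])
  then have "Hmat (- t) ** (Hmat t ** matrix_inv (Hmat t)) = Hmat (- t)"
    by (simp add: matrix_mul_rid)
  then show ?thesis
    by (simp add: matrix_mul_assoc Hmat_matrix_mult Hmat_zero matrix_mul_lid)
qed

lemma Hpow_eq_Hmat: "Hpow t k x = Hmat (of_int k * t) *v x"
proof -
  have iter: "((*v) (Hmat s) ^^ m) x = Hmat (real m * s) *v x" for s m
    by (induction m) (simp_all add: Hmat_zero Hmat_mult_Hmat algebra_simps)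
  show ?thesis
    using iter[where s = t and m = "nat k"] iter[where s = "- t" and m = "nat (- k)"]
    by (simp add: Hpow_def matrix_inv_Hmat)
qed

lemma lor_Hmat: "lor (Hmat s *v x) (Hmat s *v y) = lor x y"
proof -
  have "lor (Hmat s *v x) (Hmat s *v y) = ((cosh s)\<^sup>2 - (sinh s)\<^sup>2) * lor x y"
    by (simp add: lor_def algebra_simps power2_eq_square)
  then show ?thesis
    by (simp add: cosh_square_eq)
qed

lemma lor_eq_inner: "lor x y = (\<chi> i. if i = 1 then y$1 else - y$2) \<bullet> x"
  by (simp add: lor_def inner_vec_def sum_2)

lemma lor_add_scaleR: "lor (a *\<^sub>R x + b *\<^sub>R y) w = a * lor x w + b * lor y w"
  by (simp add: lor_def algebra_simps)

lemma lor_scaleR_hyperbola_point: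
  "lor (r *\<^sub>R hyperbola_point a) (hyperbola_point b) = - r * cosh (a - b)"
  by (simp add: lor_def cosh_diff algebra_simps)

lemma lor_hyperbola_point_exp:
  "lor x (hyperbola_point p) = - ((x$2 - x$1) * exp p + (x$2 + x$1) * exp (- p)) / 2"
  by (simp add: lor_def sinh_def cosh_def algebra_simps exp_minus divide_simps)

lemma lor_le_neg_cosh:
  assumes "y$2 - y$1 \<ge> c" "y$2 + y$1 \<ge> c"
  shows "lor y (hyperbola_point p) \<le> - c * cosh p"
proof -
  have "c * exp p \<le> (y$2 - y$1) * exp p" "c * exp (- p) \<le> (y$2 + y$1) * exp (- p)"
    using assms by (simp_all add: mult_right_mono)
  then show ?thesis
    by (simp add: lor_hyperbola_point_exp cosh_def field_simps)
qed

lemma hyperbola_eq_hyperbola_point: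
  assumes "x \<in> hyperbola" shows "x = hyperbola_point (arsinh (x$1))"
proof -
  from assms have x: "(x$2)\<^sup>2 = (x$1)\<^sup>2 + 1" "x$2 > 0"
    by (auto simp: hyperbola_def lor_def power2_eq_square)
  have "(cosh (arsinh (x$1)))\<^sup>2 = (x$2)\<^sup>2"
    by (simp add: cosh_square_eq x)
  then have "cosh (arsinh (x$1)) = x$2"
    using x(2) by (simp add: power2_eq_iff_nonneg less_imp_le)
  then show ?thesis by (simp add: vec2_eq_iff)
qed

lemma Hmat_hyperbola_point_hyperbola:
  assumes "x \<in> hyperbola" shows "Hmat s *v x = hyperbola_point (arsinh (x$1) + s)"
  using Hmat_hyperbola_point[of s "arsinh (x$1)"]
  by (simp only: hyperbola_eq_hyperbola_point[OF assms, symmetric])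

lemma future_cone_polar:
  assumes "x \<in> future_cone"
  obtains r a where "r > 0" "x = r *\<^sub>R hyperbola_point a"
proof
  from assms have x: "(x$1)\<^sup>2 < (x$2)\<^sup>2" "x$2 > 0"
    by (auto simp: future_cone_def lor_def power2_eq_square)
  define r where "r = sqrt ((x$2)\<^sup>2 - (x$1)\<^sup>2)"
  show r: "r > 0" using x by (simp add: r_def)
  have "(r * cosh (arsinh (x$1 / r)))\<^sup>2 = (x$2)\<^sup>2"
    using r x by (simp add: power_mult_distrib cosh_square_eq field_simps r_def)
  then have "r * cosh (arsinh (x$1 / r)) = x$2"
    using r x(2) by (simp add: power2_eq_iff_nonneg less_imp_le)
  with r show "x = r *\<^sub>R hyperbola_point (arsinh (x$1 / r))"
    by (simp add: vec2_eq_iff)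
qed

lemma hyperbola_point_conic_combination:
  assumes "a < b"
  shows "hyperbola_point c =
    (sinh (b - c) / sinh (b - a)) *\<^sub>R hyperbola_point a + (sinh (c - a) / sinh (b - a)) *\<^sub>R hyperbola_point b"
proof -
  have "sinh (b - a) \<noteq> 0" using assms by simp
  moreover have "sinh (b - c) * sinh a + sinh (c - a) * sinh b = sinh (b - a) * sinh c"
    "sinh (b - c) * cosh a + sinh (c - a) * cosh b = sinh (b - a) * cosh c"
    unfolding sinh_diff by algebra+
  ultimately show ?thesis
    by (simp add: vec2_eq_iff add_divide_distrib[symmetric])
qed

lemma scaleR_hyperbola_point_eq_iff:
  assumes "r > 0" "s > 0"
  shows "r *\<^sub>R hyperbola_point a = s *\<^sub>R hyperbola_point b \<longleftrightarrow> r = s \<and> a = b"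
proof
  assume "r *\<^sub>R hyperbola_point a = s *\<^sub>R hyperbola_point b"
  then have sinh: "r * sinh a = s * sinh b" and cosh: "r * cosh a = s * cosh b"
    by (simp_all add: vec2_eq_iff)
  then have "r * s * sinh (a - b) = 0"
    unfolding sinh_diff by algebra
  then have "a = b" using assms by simp
  with cosh show "r = s \<and> a = b" by simp
qed simp

lemma hyperbola_point_nonzero: "hyperbola_point a \<noteq> 0"
  by (simp add: vec2_eq_iff)

lemma convex_lor_halfplane: "convex {x. lor x w \<le> c}"
  by (simp add: lor_eq_inner convex_halfspace_le)

lemma closed_lor_halfplane: "closed {x. lor x w \<le> c}"
  by (simp add: lor_eq_inner closed_halfspace_le)

lemma mem_frontier_if_supporting_line:
  assumes "y \<in> S" "S \<subseteq> {x. lor x w \<le> c}" "lor y w = c" "w \<noteq> 0"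
  shows "y \<in> frontier S"
proof -
  define w' :: "real^2" where "w' = (\<chi> i. if i = 1 then w$1 else - w$2)"
  have "w' \<noteq> 0" using assms(4) by (simp add: w'_def vec2_eq_iff)
  then have "interior S \<subseteq> {x. w' \<bullet> x < c}"
    using interior_mono[OF assms(2)] by (simp add: lor_eq_inner w'_def)
  then have "y \<notin> interior S" using assms(3) by (auto simp: lor_eq_inner w'_def)
  with assms(1) show ?thesis
    by (simp add: frontier_def closure_subset[THEN subsetD])
qed

section \<open>Spacelike lines in hyperbolic polar coordinates\<close>

definition line_radius :: "real \<Rightarrow> real \<Rightarrow> real \<Rightarrow> real" where
  "line_radius c \<psi> \<theta> = c / cosh (\<theta> - \<psi>)"

definition line_point :: "real \<Rightarrow> real \<Rightarrow> real \<Rightarrow> real^2" where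
  "line_point c \<psi> \<theta> = line_radius c \<psi> \<theta> *\<^sub>R hyperbola_point \<theta>"

lemma line_radius_pos: "c > 0 \<Longrightarrow> line_radius c \<psi> \<theta> > 0"
  by (simp add: line_radius_def)

lemma continuous_on_line_radius: "continuous_on S (line_radius c \<psi>)"
  unfolding line_radius_def by (intro continuous_intros) simp

lemma lor_scaleR_hyperbola_point_le_iff:
  "lor (r *\<^sub>R hyperbola_point \<theta>) (hyperbola_point \<psi>) \<le> - c \<longleftrightarrow> line_radius c \<psi> \<theta> \<le> r"
proof -
  have "cosh (\<theta> - \<psi>) > 0" by simp
  then show ?thesis
    by (simp add: lor_scaleR_hyperbola_point line_radius_def divide_le_eq)
qed

lemma lor_scaleR_hyperbola_point_eq_iff:
  "lor (r *\<^sub>R hyperbola_point \<theta>) (hyperbola_point \<psi>) = - c \<longleftrightarrow> line_radius c \<psi> \<theta> = r"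
proof -
  have "cosh (\<theta> - \<psi>) > 0" by simp
  then show ?thesis
    by (auto simp: lor_scaleR_hyperbola_point line_radius_def divide_eq_eq)
qed

lemma lor_line_point: "lor (line_point c \<psi> \<theta>) (hyperbola_point \<psi>) = - c"
  unfolding line_point_def by (simp add: lor_scaleR_hyperbola_point_eq_iff)

lemma line_point_eq_iff:
  assumes "c > 0" shows "line_point c \<psi> a = line_point c \<psi> b \<longleftrightarrow> a = b"
  using assms by (auto simp: line_point_def scaleR_hyperbola_point_eq_iff line_radius_pos)

text \<open>After clearing denominators, both sides are combinations of \<open>exp \<theta>\<close> and \<open>exp (- \<theta>)\<close>.\<close>
lemma line_radius_eq_twice:
  assumes "line_radius c \<psi> x = line_radius c' \<psi>' x" "line_radius c \<psi> y = line_radius c' \<psi>' y" "x \<noteq> y"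
  shows "line_radius c \<psi> \<theta> = line_radius c' \<psi>' \<theta>"
proof -
  define A where "A = c * exp (- \<psi>') - c' * exp (- \<psi>)"
  define B where "B = c * exp \<psi>' - c' * exp \<psi>"
  have cosh_shift: "2 * cosh (z - w) = exp (- w) * exp z + exp w * exp (- z)" for z w :: real
    by (simp add: cosh_def exp_diff exp_minus field_simps)
  have iff: "line_radius c \<psi> z = line_radius c' \<psi>' z \<longleftrightarrow> A * exp z + B * exp (- z) = 0" for z
  proof -
    have "line_radius c \<psi> z = line_radius c' \<psi>' z \<longleftrightarrow>
          c * (2 * cosh (z - \<psi>')) = c' * (2 * cosh (z - \<psi>))"
      by (simp add: line_radius_def divide_eq_eq field_simps)
    also have "\<dots> \<longleftrightarrow> A * exp z + B * exp (- z) = 0"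
      unfolding cosh_shift A_def B_def by (simp add: algebra_simps)
    finally show ?thesis .
  qed
  have "A = 0 \<and> B = 0"
    using assms by (intro exp_combination_eq_0_twice[of A x B y]) (simp_all add: iff)
  then show ?thesis by (simp add: iff)
qed

lemma finite_line_radius_crossings:
  assumes "line_radius c \<psi> w \<noteq> line_radius c' \<psi>' w"
  shows "finite {z. line_radius c \<psi> z = line_radius c' \<psi>' z}" (is "finite ?Z")
proof (cases "?Z = {}")
  case False
  then obtain z where z: "z \<in> ?Z" by blast
  have "?Z \<subseteq> {z}"
  proof
    fix y assume "y \<in> ?Z"
    then have "y = z" using z assms line_radius_eq_twice[of c \<psi> y c' \<psi>' z w] by auto
    then show "y \<in> {z}" by simp
  qed
  then show ?thesis by (rule finite_subset) simp
qed (simp only: finite.emptyI)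

lemma line_point_in_closed_segment:
  assumes "c > 0" "a \<le> \<theta>" "\<theta> \<le> b"
  shows "line_point c \<psi> \<theta> \<in> closed_segment (line_point c \<psi> a) (line_point c \<psi> b)"
proof (cases "a = b")
  case True then show ?thesis using assms by simp
next
  case False
  then have ab: "a < b" using assms by simp
  define \<rho> where "\<rho> = line_radius c \<psi>"
  have \<rho>: "\<rho> z > 0" for z using assms(1) by (simp add: \<rho>_def line_radius_pos)
  define \<alpha> where "\<alpha> = \<rho> \<theta> * (sinh (b - \<theta>) / sinh (b - a)) / \<rho> a"
  define \<beta> where "\<beta> = \<rho> \<theta> * (sinh (\<theta> - a) / sinh (b - a)) / \<rho> b"
  have nonneg: "\<alpha> \<ge> 0" "\<beta> \<ge> 0"
    using assms ab \<rho>[of \<theta>] \<rho>[of a] \<rho>[of b]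
    by (simp_all add: \<alpha>_def \<beta>_def less_imp_le)
  have comb: "line_point c \<psi> \<theta> = \<alpha> *\<^sub>R line_point c \<psi> a + \<beta> *\<^sub>R line_point c \<psi> b"
    using \<rho>[of a] \<rho>[of b]
    by (simp add: line_point_def \<rho>_def[symmetric] \<alpha>_def \<beta>_def
        hyperbola_point_conic_combination[OF ab, of \<theta>] scaleR_add_right)
  have "lor (line_point c \<psi> \<theta>) (hyperbola_point \<psi>) =
    \<alpha> * lor (line_point c \<psi> a) (hyperbola_point \<psi>) + \<beta> * lor (line_point c \<psi> b) (hyperbola_point \<psi>)"
    by (simp only: comb lor_add_scaleR)
  then have "- c = \<alpha> * - c + \<beta> * - c"
    by (simp only: lor_line_point)
  then have "(\<alpha> + \<beta>) * c = 1 * c" by (simp add: algebra_simps)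
  then have "\<alpha> + \<beta> = 1" using assms(1) by simp
  then show ?thesis
    using comb nonneg by (auto simp: in_segment intro!: exI[of _ \<beta>])
qed

section \<open>\<open>t\<close>-convex polygons\<close>

locale t_polygon =
  fixes t :: real and n :: nat and \<eta> :: "nat \<Rightarrow> real^2" and h :: "nat \<Rightarrow> real"
  assumes t_pos: "t > 0" and n_pos: "n \<ge> 1"
    and \<eta>_hyperbola: "\<And>i. i < n \<Longrightarrow> \<eta> i \<in> hyperbola" and h_pos: "\<And>i. i < n \<Longrightarrow> h i > 0"
begin

text \<open>Face \<open>(k, i)\<close> lies on the line \<open>(H\<^sub>t\<^sup>k (h\<^sub>i \<eta>\<^sub>i))\<^sup>\<bottom>\<close>, whose normal \<open>H\<^sub>t\<^sup>k \<eta>\<^sub>i\<close> is the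
  hyperbola point of rapidity \<open>rapidity (k, i)\<close>.\<close>
definition faces :: "(int \<times> nat) set" where
  "faces = UNIV \<times> {..<n}"

definition rapidity :: "int \<times> nat \<Rightarrow> real" where
  "rapidity j = arsinh (\<eta> (snd j) $ 1) + of_int (fst j) * t"

definition polygon :: "(real^2) set" where
  "polygon = {x. \<forall>j\<in>faces. lor x (hyperbola_point (rapidity j)) \<le> - h (snd j)}"

abbreviation radius :: "int \<times> nat \<Rightarrow> real \<Rightarrow> real" where
  "radius j \<equiv> line_radius (h (snd j)) (rapidity j)"

definition hmax :: real where
  "hmax = Max (h ` {..<n})"

lemma faces_iff [simp]: "(k, i) \<in> faces \<longleftrightarrow> i < n"
  by (simp add: faces_def)

lemma h_face_pos: "j \<in> faces \<Longrightarrow> h (snd j) > 0"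
  by (cases j) (simp add: h_pos)

lemma h_le_hmax: "i < n \<Longrightarrow> h i \<le> hmax"
  by (simp add: hmax_def)

lemma hmax_pos: "hmax > 0"
  using h_pos[of 0] h_le_hmax[of 0] n_pos by simp

lemma Hpow_\<eta>:
  assumes "i < n" shows "Hpow t k (\<eta> i) = hyperbola_point (rapidity (k, i))"
  using Hmat_hyperbola_point_hyperbola[OF \<eta>_hyperbola[OF assms]]
  by (simp add: Hpow_eq_Hmat rapidity_def)

lemma Inter_halfplane_eq_polygon:
  "(\<Inter>k. \<Inter>i\<in>{..<n}. halfplane t k (h i) (\<eta> i)) = polygon"
  by (auto simp: polygon_def halfplane_def faces_def Hpow_\<eta>)

lemma polygon_eq_INT_lor_halfplane:
  "polygon = (\<Inter>j\<in>faces. {x. lor x (hyperbola_point (rapidity j)) \<le> - h (snd j)})"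
  by (auto simp: polygon_def)

lemma convex_polygon: "convex polygon"
  unfolding polygon_eq_INT_lor_halfplane by (intro convex_INT ballI convex_lor_halfplane)

lemma closed_polygon: "closed polygon"
  unfolding polygon_eq_INT_lor_halfplane by (intro closed_INT ballI closed_lor_halfplane)

lemma scaleR_hyperbola_point_mem_polygon_iff:
  "r *\<^sub>R hyperbola_point \<theta> \<in> polygon \<longleftrightarrow> (\<forall>j\<in>faces. radius j \<theta> \<le> r)"
  by (simp add: polygon_def lor_scaleR_hyperbola_point_le_iff)

lemma hmax_point_mem_polygon: "hmax *\<^sub>R hyperbola_point 0 \<in> polygon"
proof -
  have "h (snd j) \<le> hmax * cosh (rapidity j)" if "j \<in> faces" for j
  proof -
    have "h (snd j) \<le> hmax" using that by (cases j) (simp add: h_le_hmax)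
    also have "\<dots> \<le> hmax * cosh (rapidity j)"
      using hmax_pos by (simp add: cosh_real_ge_1)
    finally show ?thesis .
  qed
  then show ?thesis
    by (simp add: polygon_def lor_scaleR_hyperbola_point)
qed

lemma zero_notin_polygon: "0 \<notin> polygon"
  using h_pos[of 0] n_pos by (auto simp: polygon_def lor_def intro!: bexI[of _ "(0, 0)"])

lemma polygon_lightcone_pos:
  assumes "x \<in> polygon"
  shows "x$2 - x$1 > 0" "x$2 + x$1 > 0"
proof -
  define \<phi> where "\<phi> = arsinh (\<eta> 0 $ 1)"
  have h0: "2 * h 0 > 0" using h_pos[of 0] n_pos by simp
  have bound: "(x$2 - x$1) * exp (\<phi> + of_int k * t) + (x$2 + x$1) * exp (- (\<phi> + of_int k * t)) \<ge> 2 * h 0"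
    for k :: int
  proof -
    have "(k, 0) \<in> faces" using n_pos by simp
    with assms have "lor x (hyperbola_point (rapidity (k, 0))) \<le> - h 0"
      unfolding polygon_def by fastforce
    then show ?thesis by (simp add: lor_hyperbola_point_exp rapidity_def \<phi>_def)
  qed
  show "x$2 - x$1 > 0"
  proof (rule ccontr)
    assume "\<not> x$2 - x$1 > 0"
    then have nonpos: "(x$2 - x$1) * exp (\<phi> + real k * t) \<le> 0" for k :: nat
      by (simp add: mult_nonpos_nonneg)
    have "2 * h 0 \<le> (x$2 + x$1) * exp (- (\<phi> + real k * t))" for k :: nat
      using bound[of "int k"] nonpos[of k] by simp
    with exp_decay_not_bounded_below[OF h0 t_pos] show False by blast
  qed
  show "x$2 + x$1 > 0"
  proof (rule ccontr)
    assume "\<not> x$2 + x$1 > 0"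
    then have nonpos: "(x$2 + x$1) * exp (- (\<phi> - real k * t)) \<le> 0" for k :: nat
      by (simp add: mult_nonpos_nonneg)
    have "2 * h 0 \<le> (x$2 - x$1) * exp (- (- \<phi> + real k * t))" for k :: nat
      using bound[of "- int k"] nonpos[of k] by simp
    with exp_decay_not_bounded_below[OF h0 t_pos] show False by blast
  qed
qed

lemma polygon_subset_future_cone: "polygon \<subseteq> future_cone"
proof
  fix x assume "x \<in> polygon"
  from polygon_lightcone_pos[OF this] have "(x$2 - x$1) * (x$2 + x$1) > 0" "x$2 > 0"
    by simp_all
  then show "x \<in> future_cone"
    by (simp add: future_cone_def lor_def algebra_simps)
qed

lemma Hmat_mem_polygon:
  assumes "x \<in> polygon" shows "Hmat (of_int m * t) *v x \<in> polygon"
proof -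
  have "lor (Hmat (of_int m * t) *v x) (hyperbola_point (rapidity (k, i))) =
        lor x (hyperbola_point (rapidity (k - m, i)))" for k i
  proof -
    have "hyperbola_point (rapidity (k, i)) = Hmat (of_int m * t) *v hyperbola_point (rapidity (k - m, i))"
      by (simp add: Hmat_hyperbola_point rapidity_def algebra_simps)
    then show ?thesis by (simp add: lor_Hmat)
  qed
  with assms show ?thesis by (auto simp: polygon_def faces_def)
qed

lemma Hpow_image_polygon: "Hpow t m ` polygon = polygon"
proof
  show "Hpow t m ` polygon \<subseteq> polygon"
    using Hmat_mem_polygon by (auto simp: Hpow_eq_Hmat)
  show "polygon \<subseteq> Hpow t m ` polygon"
  proof
    fix x assume "x \<in> polygon"
    then have "Hmat (of_int (- m) * t) *v x \<in> polygon" by (rule Hmat_mem_polygon)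
    moreover have "x = Hpow t m (Hmat (of_int (- m) * t) *v x)"
      by (simp add: Hpow_eq_Hmat Hmat_mult_Hmat Hmat_zero)
    ultimately show "x \<in> Hpow t m ` polygon" by blast
  qed
qed

lemma finite_faces_rapidity_bounded: "finite {j\<in>faces. \<bar>rapidity j\<bar> < M}"
proof (rule finite_subset)
  show "{j\<in>faces. \<bar>rapidity j\<bar> < M} \<subseteq>
        (\<Union>i<n. (\<lambda>k. (k, i)) ` {k. \<bar>arsinh (\<eta> i $ 1) + of_int k * t\<bar> < M})"
    by (auto simp: faces_def rapidity_def)
  show "finite \<dots>"
    using finite_int_affine_bounded[OF t_pos] by blast
qed

text \<open>Only finitely many faces come close to a given point; the others are kept away by the
  growth of \<open>cosh\<close>, so strict inequalities for all faces define an open neighbourhood.\<close>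
lemma mem_interior_polygon:
  assumes x: "x \<in> polygon" and strict: "\<forall>j\<in>faces. lor x (hyperbola_point (rapidity j)) < - h (snd j)"
  shows "x \<in> interior polygon"
proof -
  define c where "c = min (x$2 - x$1) (x$2 + x$1)"
  have c: "c > 0" using polygon_lightcone_pos[OF x] by (simp add: c_def)
  define J where "J = {j\<in>faces. \<bar>rapidity j\<bar> < 4 * hmax / c}"
  define U where "U = (\<Inter>j\<in>J. {y. lor y (hyperbola_point (rapidity j)) < - h (snd j)}) \<inter> ball x (c / 4)"
  have "open U"
    using finite_faces_rapidity_bounded unfolding U_def J_def
    by (intro open_Int open_INT ballI) (simp_all add: lor_eq_inner open_halfspace_lt)
  moreover have "x \<in> U" using strict c by (auto simp: U_def J_def)
  moreover have "U \<subseteq> polygon"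
  proof
    fix y assume y: "y \<in> U"
    have near: "\<bar>y$i - x$i\<bar> < c / 4" for i
      using y component_le_norm_cart[of "y - x" i] by (auto simp: U_def dist_norm norm_minus_commute)
    have "c \<le> x$2 - x$1" "c \<le> x$2 + x$1" by (simp_all add: c_def)
    with near[of 1, unfolded abs_less_iff] near[of 2, unfolded abs_less_iff]
    have coords: "y$2 - y$1 \<ge> c / 2" "y$2 + y$1 \<ge> c / 2"
      by linarith+
    show "y \<in> polygon" unfolding polygon_def
    proof (intro CollectI ballI)
      fix j assume j: "j \<in> faces"
      show "lor y (hyperbola_point (rapidity j)) \<le> - h (snd j)"
      proof (cases "j \<in> J")
        case True then show ?thesis using y by (auto simp: U_def)
      next
        case False
        then have far: "\<bar>rapidity j\<bar> \<ge> 4 * hmax / c" using j by (simp add: J_def)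
        have "lor y (hyperbola_point (rapidity j)) \<le> - (c / 2) * cosh (rapidity j)"
          using coords by (rule lor_le_neg_cosh)
        also have "\<dots> < - (c / 2) * (\<bar>rapidity j\<bar> / 2)"
          using c cosh_gt_abs_half[of "rapidity j"] by simp
        also have "\<dots> \<le> - hmax"
          using c far by (simp add: field_simps)
        also have "\<dots> \<le> - h (snd j)"
          using j by (cases j) (simp add: h_le_hmax)
        finally show ?thesis by simp
      qed
    qed
  qed
  ultimately show ?thesis by (rule interiorI)
qed

lemma mem_frontier_polygon:
  assumes "y \<in> polygon" "j \<in> faces" "lor y (hyperbola_point (rapidity j)) = - h (snd j)"
  shows "y \<in> frontier polygon"
proof (rule mem_frontier_if_supporting_line[OF assms(1) _ assms(3)])
  show "polygon \<subseteq> {x. lor x (hyperbola_point (rapidity j)) \<le> - h (snd j)}"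
    using assms(2) by (auto simp: polygon_def)
  show "hyperbola_point (rapidity j) \<noteq> 0"
    by (rule hyperbola_point_nonzero)
qed

lemma radius_shift: "radius (k + m, i) (\<theta> + of_int m * t) = radius (k, i) \<theta>"
  by (simp add: line_radius_def rapidity_def algebra_simps)

definition radius_lower :: real where
  "radius_lower = h 0 / cosh (\<bar>rapidity (0, 0)\<bar> + t)"

text \<open>Every face that is maximal somewhere on \<open>[0, t]\<close> lies in \<open>near_faces\<close>: the radius of
  any other face stays below \<open>radius_lower\<close>, a lower bound for the radius of face \<open>(0, 0)\<close>.\<close>
definition near_faces :: "(int \<times> nat) set" where
  "near_faces = {j\<in>faces. \<bar>rapidity j\<bar> < 2 * hmax / radius_lower + t}"

definition breakpoints :: "real set" where
  "breakpoints = insert 0 {z\<in>{0<..<t}. \<exists>a\<in>near_faces. \<exists>b\<in>near_faces.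
     radius a z = radius b z \<and> (\<exists>w. radius a w \<noteq> radius b w)}"

lemma radius_lower_pos: "radius_lower > 0"
  using h_pos[of 0] n_pos by (simp add: radius_lower_def)

lemma radius_lower_le: "\<theta> \<in> {0..t} \<Longrightarrow> radius_lower \<le> radius (0, 0) \<theta>"
proof -
  assume "\<theta> \<in> {0..t}"
  then have "\<bar>\<theta> - rapidity (0, 0)\<bar> \<le> \<bar>rapidity (0, 0)\<bar> + t"
    using abs_triangle_ineq4[of \<theta> "rapidity (0, 0)"] by auto
  then have "cosh (\<theta> - rapidity (0, 0)) \<le> cosh (\<bar>rapidity (0, 0)\<bar> + t)"
    using t_pos by (subst cosh_real_abs[symmetric], subst cosh_real_nonneg_le_iff) auto
  then show ?thesis
    using h_pos[of 0] n_pos by (simp add: radius_lower_def line_radius_def divide_left_mono)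
qed

lemma mem_near_faces:
  assumes j: "j \<in> faces" and \<theta>: "\<theta> \<in> {0..t}" and ge: "radius_lower \<le> radius j \<theta>"
  shows "j \<in> near_faces"
proof -
  have "radius_lower * cosh (\<theta> - rapidity j) \<le> h (snd j)"
    using ge by (simp add: line_radius_def le_divide_eq)
  also have "\<dots> \<le> hmax" using j by (cases j) (simp add: h_le_hmax)
  finally have "cosh (\<theta> - rapidity j) \<le> hmax / radius_lower"
    using radius_lower_pos by (simp add: le_divide_eq mult.commute)
  then have "\<bar>\<theta> - rapidity j\<bar> < 2 * hmax / radius_lower"
    using cosh_gt_abs_half[of "\<theta> - rapidity j"] by simp
  with \<theta> have "\<bar>rapidity j\<bar> < 2 * hmax / radius_lower + t" by auto
  with j show ?thesis by (simp add: near_faces_def)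
qed

lemma finite_near_faces: "finite near_faces"
  unfolding near_faces_def by (rule finite_faces_rapidity_bounded)

lemma finite_breakpoints: "finite breakpoints"
proof -
  let ?crossing = "\<lambda>(a, b). {z. radius a z = radius b z}"
  let ?pairs = "{(a, b) \<in> near_faces \<times> near_faces. \<exists>w. radius a w \<noteq> radius b w}"
  have "finite (?crossing ab)" if "ab \<in> ?pairs" for ab
    using that by (auto intro: finite_line_radius_crossings)
  moreover have "finite ?pairs"
    by (rule finite_subset[of _ "near_faces \<times> near_faces"]) (auto simp: finite_near_faces)
  ultimately have "finite (insert 0 (\<Union>ab\<in>?pairs. ?crossing ab))" by blast
  then show ?thesis
    unfolding breakpoints_def by (rule finite_subset[rotated]) auto
qed

lemma dominant_face_on_gap:
  assumes "0 \<le> p" "p < q" "q \<le> t" "{p<..<q} \<inter> breakpoints = {}"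
  shows "\<exists>d\<in>faces. \<forall>j\<in>faces. \<forall>\<theta>\<in>{p..q}. radius j \<theta> \<le> radius d \<theta>"
proof -
  have near00: "(0, 0) \<in> near_faces"
    using mem_near_faces[of "(0, 0)" 0] radius_lower_le[of 0] n_pos t_pos by simp
  have cont: "continuous_on {p..q} (radius j)" if "j \<in> near_faces" for j
    by (rule continuous_on_line_radius)
  have cross: "\<forall>x\<in>{p..q}. radius a x = radius b x"
    if "a \<in> near_faces" "b \<in> near_faces" "z \<in> {p<..<q}" "radius a z = radius b z" for a b z
  proof (rule ccontr)
    assume "\<not> (\<forall>x\<in>{p..q}. radius a x = radius b x)"
    then have "\<exists>w. radius a w \<noteq> radius b w" by blast
    moreover have "z \<in> {0<..<t}" using that(3) assms(1,3) by auto
    ultimately have "z \<in> breakpoints"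
      using that(1,2,4) unfolding breakpoints_def by blast
    with that(3) assms(4) show False by blast
  qed
  have "near_faces \<noteq> {}" using near00 by blast
  from finite_family_dominant[where f = radius, OF finite_near_faces this \<open>p < q\<close> cont cross]
  obtain d where d: "d \<in> near_faces" and dom: "\<forall>j\<in>near_faces. \<forall>\<theta>\<in>{p..q}. radius j \<theta> \<le> radius d \<theta>" ..
  show ?thesis
  proof (intro bexI ballI)
    show "d \<in> faces" using d by (simp add: near_faces_def)
    fix j \<theta> assume j: "j \<in> faces" and \<theta>: "\<theta> \<in> {p..q}"
    then have \<theta>': "\<theta> \<in> {0..t}" using assms by auto
    show "radius j \<theta> \<le> radius d \<theta>"
    proof (cases "j \<in> near_faces")
      case False
      then have "radius j \<theta> < radius_lower" using mem_near_faces[OF j \<theta>'] by (meson not_le)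
      also have "\<dots> \<le> radius (0, 0) \<theta>" using \<theta>' by (rule radius_lower_le)
      also have "\<dots> \<le> radius d \<theta>" by (rule dom[rule_format, OF near00 \<theta>])
      finally show ?thesis by simp
    qed (rule dom[rule_format, OF _ \<theta>])
  qed
qed

lemma polygon_piecewise_dominant:
  obtains s :: "int \<Rightarrow> real" and d :: "int \<Rightarrow> int \<times> nat"
  where "\<And>k. s k < s (k + 1)" "\<And>\<theta>. \<exists>k. s k \<le> \<theta> \<and> \<theta> \<le> s (k + 1)" "\<And>k. d k \<in> faces"
    "\<And>k j \<theta>. j \<in> faces \<Longrightarrow> \<theta> \<in> {s k..s (k + 1)} \<Longrightarrow> radius j \<theta> \<le> radius (d k) \<theta>"
proof -
  have zero: "0 \<in> breakpoints" and sub: "breakpoints \<subseteq> {0..<t}"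
    using t_pos by (auto simp: breakpoints_def)
  obtain s :: "int \<Rightarrow> real" where s: "\<forall>k. s k < s (k + 1)" "\<forall>\<theta>. \<exists>k. s k \<le> \<theta> \<and> \<theta> \<le> s (k + 1)"
    "\<forall>k. \<exists>q::int. 0 \<le> s k - q * t \<and> s (k + 1) - q * t \<le> t \<and>
                  {s k - q * t <..< s (k + 1) - q * t} \<inter> breakpoints = {}"
    using periodic_enumeration[OF finite_breakpoints zero sub] by blast
  have "\<exists>d\<in>faces. \<forall>j\<in>faces. \<forall>\<theta>\<in>{s k..s (k + 1)}. radius j \<theta> \<le> radius d \<theta>" for k
  proof -
    obtain q :: int where q: "0 \<le> s k - q * t" "s (k + 1) - q * t \<le> t"
      "{s k - q * t <..< s (k + 1) - q * t} \<inter> breakpoints = {}"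
      using s(3) by blast
    have "s k - q * t < s (k + 1) - q * t" using s(1) by simp
    from dominant_face_on_gap[OF q(1) this q(2,3)] obtain d where d: "d \<in> faces"
      "\<forall>j\<in>faces. \<forall>\<theta>\<in>{s k - q * t..s (k + 1) - q * t}. radius j \<theta> \<le> radius d \<theta>" ..
    show ?thesis
    proof (intro bexI ballI)
      show "(fst d + q, snd d) \<in> faces" using d(1) by (cases d) simp
      fix j \<theta> assume j: "j \<in> faces" and \<theta>: "\<theta> \<in> {s k..s (k + 1)}"
      have "(fst j - q, snd j) \<in> faces" using j by (cases j) simp
      moreover have "\<theta> - q * t \<in> {s k - q * t..s (k + 1) - q * t}" using \<theta> by simp
      ultimately have "radius (fst j - q, snd j) (\<theta> - q * t) \<le> radius d (\<theta> - q * t)"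
        using d(2) by blast
      then show "radius j \<theta> \<le> radius (fst d + q, snd d) \<theta>"
        using radius_shift[of "fst j - q" q "snd j" "\<theta> - q * t"]
          radius_shift[of "fst d" q "snd d" "\<theta> - q * t"] by simp
    qed
  qed
  then obtain d where "\<forall>k. d k \<in> faces \<and>
      (\<forall>j\<in>faces. \<forall>\<theta>\<in>{s k..s (k + 1)}. radius j \<theta> \<le> radius (d k) \<theta>)"
    by metis
  with s(1,2) show thesis by (intro that[of s d]) auto
qed

abbreviation face_point :: "int \<times> nat \<Rightarrow> real \<Rightarrow> real^2" where
  "face_point j \<equiv> line_point (h (snd j)) (rapidity j)"

context
  fixes s :: "int \<Rightarrow> real" and d :: "int \<Rightarrow> int \<times> nat"
  assumes s_mono: "\<And>k. s k < s (k + 1)" and s_cover: "\<And>\<theta>. \<exists>k. s k \<le> \<theta> \<and> \<theta> \<le> s (k + 1)"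
    and d_face: "\<And>k. d k \<in> faces"
    and d_dominant: "\<And>k j \<theta>. j \<in> faces \<Longrightarrow> \<theta> \<in> {s k..s (k + 1)} \<Longrightarrow> radius j \<theta> \<le> radius (d k) \<theta>"
begin

lemma face_point_mem_polygon: "\<theta> \<in> {s k..s (k + 1)} \<Longrightarrow> face_point (d k) \<theta> \<in> polygon"
  unfolding line_point_def scaleR_hyperbola_point_mem_polygon_iff using d_dominant by blast

lemma face_point_next: "face_point (d (k + 1)) (s (k + 1)) = face_point (d k) (s (k + 1))"
proof -
  have "s (k + 1) \<in> {s k..s (k + 1)}" "s (k + 1) \<in> {s (k + 1)..s (k + 1 + 1)}"
    using s_mono[of k] s_mono[of "k + 1"] by auto
  then have "radius (d (k + 1)) (s (k + 1)) = radius (d k) (s (k + 1))"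
    using d_dominant d_face by (meson antisym)
  then show ?thesis by (simp add: line_point_def)
qed

lemma closed_segment_subset_frontier:
  "closed_segment (face_point (d k) (s k)) (face_point (d k) (s (k + 1))) \<subseteq> frontier polygon"
proof
  fix y assume y: "y \<in> closed_segment (face_point (d k) (s k)) (face_point (d k) (s (k + 1)))"
  have "face_point (d k) (s k) \<in> polygon" "face_point (d k) (s (k + 1)) \<in> polygon"
    using s_mono[of k] by (auto intro: face_point_mem_polygon)
  then have "y \<in> polygon"
    using y convex_polygon by (meson closed_segment_subset subsetD)
  moreover obtain u where u: "y = (1 - u) *\<^sub>R face_point (d k) (s k) + u *\<^sub>R face_point (d k) (s (k + 1))"
    using y by (auto simp: in_segment)
  then have "lor y (hyperbola_point (rapidity (d k))) = (1 - u) * - h (snd (d k)) + u * - h (snd (d k))"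
    by (simp only: lor_add_scaleR lor_line_point)
  then have "lor y (hyperbola_point (rapidity (d k))) = - h (snd (d k))"
    by (simp add: algebra_simps)
  ultimately show "y \<in> frontier polygon"
    using mem_frontier_polygon d_face by blast
qed

lemma frontier_subset_closed_segments:
  "frontier polygon \<subseteq> (\<Union>k. closed_segment (face_point (d k) (s k)) (face_point (d k) (s (k + 1))))"
proof
  fix x assume x: "x \<in> frontier polygon"
  then have "x \<in> polygon" using closed_polygon by (simp add: frontier_subset_closed[THEN subsetD])
  then obtain r \<theta> where r: "r > 0" and x_polar: "x = r *\<^sub>R hyperbola_point \<theta>"
    using polygon_subset_future_cone future_cone_polar by blast
  have "x \<notin> interior polygon" using x by (simp add: frontier_def)
  then obtain j where j: "j \<in> faces" "\<not> lor x (hyperbola_point (rapidity j)) < - h (snd j)"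
    using mem_interior_polygon[OF \<open>x \<in> polygon\<close>] by blast
  then have "radius j \<theta> = r"
    using \<open>x \<in> polygon\<close> by (auto simp: polygon_def x_polar lor_scaleR_hyperbola_point_eq_iff[symmetric])
  obtain k where \<theta>: "\<theta> \<in> {s k..s (k + 1)}" using s_cover by auto
  have "radius (d k) \<theta> \<le> r"
    using \<open>x \<in> polygon\<close> d_face by (simp add: x_polar scaleR_hyperbola_point_mem_polygon_iff)
  moreover have "r \<le> radius (d k) \<theta>"
    using d_dominant[OF j(1) \<theta>] \<open>radius j \<theta> = r\<close> by simp
  ultimately have "x = face_point (d k) \<theta>"
    by (simp add: x_polar line_point_def)
  moreover have "face_point (d k) \<theta> \<in> closed_segment (face_point (d k) (s k)) (face_point (d k) (s (k + 1)))"
    using \<theta> d_face by (intro line_point_in_closed_segment) (auto simp: h_face_pos)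
  ultimately show "x \<in> (\<Union>k. closed_segment (face_point (d k) (s k)) (face_point (d k) (s (k + 1))))"
    by blast
qed

lemma vertex_neq: "face_point (d k) (s k) \<noteq> face_point (d (k + 1)) (s (k + 1))"
  using s_mono[of k] d_face[of k] by (simp add: face_point_next line_point_eq_iff h_face_pos)

lemma frontier_polygon_eq_UN_closed_segment:
  "frontier polygon = (\<Union>k. closed_segment (face_point (d k) (s k)) (face_point (d (k + 1)) (s (k + 1))))"
  using closed_segment_subset_frontier frontier_subset_closed_segments
  by (simp add: face_point_next subset_antisym UN_least)

end

lemma frontier_polygon_polygonal:
  "\<exists>v :: int \<Rightarrow> real^2. (\<forall>k. v k \<noteq> v (k + 1))
     \<and> frontier polygon = (\<Union>k. closed_segment (v k) (v (k + 1)))"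
proof (rule polygon_piecewise_dominant)
  fix s :: "int \<Rightarrow> real" and d :: "int \<Rightarrow> int \<times> nat"
  assume sd: "\<And>k. s k < s (k + 1)" "\<And>\<theta>. \<exists>k. s k \<le> \<theta> \<and> \<theta> \<le> s (k + 1)" "\<And>k. d k \<in> faces"
    "\<And>k j \<theta>. j \<in> faces \<Longrightarrow> \<theta> \<in> {s k..s (k + 1)} \<Longrightarrow> radius j \<theta> \<le> radius (d k) \<theta>"
  show ?thesis
    using vertex_neq[where s = s and d = d, OF sd]
      frontier_polygon_eq_UN_closed_segment[where s = s and d = d, OF sd]
    by (intro exI[of _ "\<lambda>k. face_point (d k) (s k)"]) simp
qed

end

theorem lemma3p3:
  fixes t :: real and P :: "(real^2) set"
  assumes "t > 0" and "t_convex_polygon t P"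
  shows "convex P \<and> P \<noteq> {} \<and> P \<noteq> UNIV \<and> P \<subseteq> future_cone
       \<and> (\<exists>v :: int \<Rightarrow> real^2. (\<forall>k. v k \<noteq> v (k + 1))
             \<and> frontier P = (\<Union>k. closed_segment (v k) (v (k + 1))))
       \<and> (\<forall>k::int. Hpow t k ` P = P)"
proof -
  obtain n :: nat and \<eta> :: "nat \<Rightarrow> real^2" and h :: "nat \<Rightarrow> real"
    where "n \<ge> 1" "\<forall>i<n. \<eta> i \<in> hyperbola" "\<forall>i<n. h i > 0"
    and P: "P = (\<Inter>k::int. \<Inter>i\<in>{..<n}. halfplane t k (h i) (\<eta> i))"
    using assms(2) unfolding t_convex_polygon_def by blast
  then interpret t_polygon t n \<eta> h
    using assms(1) by unfold_locales auto
  have "P = polygon" using P Inter_halfplane_eq_polygon by simp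
  then show ?thesis
    using convex_polygon hmax_point_mem_polygon zero_notin_polygon polygon_subset_future_cone
      frontier_polygon_polygonal Hpow_image_polygon by auto
qed

end
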